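(* Let $\alpha > 0$ and $0 < p \leq 1$. For $f \in A^\infty_\alpha$ set $$\overline s_1(f) = \operatorname{dist}_{A^\infty_\alpha}(f, B^{p,\infty}_\alpha) = \inf_{g \in B^{p,\infty}_\alpha} \| f-g\|_{A^\infty_\alpha},$$ $$\overline s_2(f) = \inf\left\{ \epsilon > 0 : \int_0^1 \left( \int_{\hat L_{\epsilon,\alpha}(f)} \frac{dr}{(1-r\rho)^{\alpha+1}} \right)^p (1-\rho)^{\alpha p-1}\, d\rho < \infty \right\}.$$ Then $\overline s_1(f) \asymp \overline s_2(f)$, with constants depending only on $\alpha$, $p$ and $n$; that is, there is a constant $C \geq 1$ depending only on $\alpha,p,n$ such that $C^{-1}\overline s_2(f) \leq \overline s_1(f) \leq C\, \overline s_2(f)$ for every $f \in A^\infty_\alpha$.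
   Context: $\mathbb B$ is the open unit ball in $\mathbb R^n$, $\mathbb S = \partial\mathbb B$ is the unit sphere, and $h(\mathbb B)$ is the space of all harmonic functions on $\mathbb B$. For $f \in h(\mathbb B)$ and $0\le r<1$, $M_\infty(f,r) = \sup_{x'\in\mathbb S}|f(rx')|$. For $\alpha>0$ and $0<p<\infty$, $$A^\infty_\alpha = \Big\{ f\in h(\mathbb B): \|f\|_{A^\infty_\alpha} = \sup_{x\in\mathbb B} |f(x)|(1-|x|)^\alpha<\infty\Big\},$$ $$B^{p,\infty}_\alpha = \Big\{ f\in h(\mathbb B): \|f\|_{B^{p,\infty}_\alpha} = \Big(\int_0^1 M_\infty(f,r)^p(1-r)^{\alpha p-1}\,dr\Big)^{1/p}<\infty\Big\}.$$ One has $B^{p,\infty}_\alpha \subset A^\infty_\alpha$. For $\epsilon>0$, $\alpha>0$ and $f\in h(\mathbb B)$, $$\hat L_{\epsilon,\alpha}(f) = \{ r : 0\le r<1,\ M_\infty(f,r)(1-r)^\alpha \ge \epsilon\}.$$ *)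

theory Defs
  imports "HOL-Analysis.Analysis"
begin

definition partial_deriv :: "'n::finite \<Rightarrow> (real^'n \<Rightarrow> real) \<Rightarrow> real^'n \<Rightarrow> real" where
  "partial_deriv i f x = frechet_derivative f (at x) (axis i 1)"

definition laplacian :: "(real^'n::finite \<Rightarrow> real) \<Rightarrow> real^'n \<Rightarrow> real" where
  "laplacian f x = (\<Sum>i\<in>UNIV. partial_deriv i (partial_deriv i f) x)"

text \<open>\<open>C2_on\<close> and \<open>harmonic_on\<close> are meant for open sets only.\<close>

definition C2_on :: "(real^'n::finite) set \<Rightarrow> (real^'n \<Rightarrow> real) \<Rightarrow> bool" where
  "C2_on S f \<longleftrightarrow> f differentiable_on S
     \<and> (\<forall>i. partial_deriv i f differentiable_on S)
     \<and> (\<forall>i j. continuous_on S (partial_deriv i (partial_deriv j f)))"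

definition harmonic_on :: "(real^'n::finite) set \<Rightarrow> (real^'n \<Rightarrow> real) \<Rightarrow> bool" where
  "harmonic_on S f \<longleftrightarrow> C2_on S f \<and> (\<forall>x\<in>S. laplacian f x = 0)"

text \<open>The power \<open>x\<^sup>p\<close> for \<open>x \<in> [0,\<infinity>]\<close> and \<open>p > 0\<close>.\<close>

definition ennpow :: "ennreal \<Rightarrow> real \<Rightarrow> ennreal" where
  "ennpow x p = (if x = \<infinity> then \<infinity> else ennreal (enn2real x powr p))"

text \<open>Functions on the unit ball are represented by total functions on \<open>real^'n\<close>; nothing below
  depends on the values outside \<open>ball 0 1\<close>.  Norms take values in \<open>[0,\<infinity>]\<close>, so that
  they are defined for every function.  The supremum in \<open>M_inf f r\<close> is real-valued: for \<open>f\<close>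
  continuous on the ball and \<open>0 \<le> r < 1\<close> it is taken over a bounded set.\<close>

definition M_inf :: "(real^'n::finite \<Rightarrow> real) \<Rightarrow> real \<Rightarrow> real" where
  "M_inf f r = (SUP x'\<in>sphere 0 1. \<bar>f (r *\<^sub>R x')\<bar>)"

definition A_norm :: "real \<Rightarrow> (real^'n::finite \<Rightarrow> real) \<Rightarrow> ennreal" where
  "A_norm \<alpha> f = (SUP x\<in>ball 0 1. ennreal (\<bar>f x\<bar> * (1 - norm x) powr \<alpha>))"

definition A_space :: "real \<Rightarrow> (real^'n::finite \<Rightarrow> real) set" where
  "A_space \<alpha> = {f. harmonic_on (ball 0 1) f \<and> A_norm \<alpha> f < \<infinity>}"

definition B_norm :: "real \<Rightarrow> real \<Rightarrow> (real^'n::finite \<Rightarrow> real) \<Rightarrow> ennreal" where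
  "B_norm p \<alpha> f = ennpow
     (\<integral>\<^sup>+r\<in>{0..<1}. ennreal (M_inf f r powr p * (1 - r) powr (\<alpha> * p - 1)) \<partial>lborel) (1 / p)"

definition B_space :: "real \<Rightarrow> real \<Rightarrow> (real^'n::finite \<Rightarrow> real) set" where
  "B_space p \<alpha> = {f. harmonic_on (ball 0 1) f \<and> B_norm p \<alpha> f < \<infinity>}"

definition L_hat :: "real \<Rightarrow> real \<Rightarrow> (real^'n::finite \<Rightarrow> real) \<Rightarrow> real set" where
  "L_hat \<epsilon> \<alpha> f = {r. 0 \<le> r \<and> r < 1 \<and> M_inf f r * (1 - r) powr \<alpha> \<ge> \<epsilon>}"

definition s1 :: "real \<Rightarrow> real \<Rightarrow> (real^'n::finite \<Rightarrow> real) \<Rightarrow> ennreal" where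
  "s1 p \<alpha> f = (INF g\<in>B_space p \<alpha>. A_norm \<alpha> (\<lambda>x. f x - g x))"

definition L_integral :: "real \<Rightarrow> real \<Rightarrow> real \<Rightarrow> (real^'n::finite \<Rightarrow> real) \<Rightarrow> ennreal" where
  "L_integral p \<alpha> \<epsilon> f =
     (\<integral>\<^sup>+\<rho>\<in>{0..<1}.
        ennpow (\<integral>\<^sup>+r\<in>L_hat \<epsilon> \<alpha> f. ennreal (1 / (1 - r * \<rho>) powr (\<alpha> + 1)) \<partial>lborel) p
          * ennreal ((1 - \<rho>) powr (\<alpha> * p - 1)) \<partial>lborel)"

definition s2 :: "real \<Rightarrow> real \<Rightarrow> (real^'n::finite \<Rightarrow> real) \<Rightarrow> ennreal" where
  "s2 p \<alpha> f = (INF \<epsilon>\<in>{\<epsilon>. 0 < \<epsilon> \<and> L_integral p \<alpha> \<epsilon> f < \<infinity>}. ennreal \<epsilon>)"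

end

theory Submission
  imports Defs
begin

text \<open>Both quantities are comparable to \<open>limsup M_inf f r * (1 - r) powr \<alpha>\<close> as \<open>r\<close> tends to 1, and no
  reproducing kernels are needed.  By the maximum principle \<open>M_inf f\<close> is increasing, so if
  \<open>M_inf f r * (1 - r) powr \<alpha> \<ge> 2 powr \<alpha> * \<epsilon>\<close>, then the whole interval \<open>[r, (1 + r) / 2]\<close> lies in
  \<open>L_hat \<epsilon> \<alpha> f\<close> and contributes a fixed amount to the integral in \<open>s2\<close>; hence that integral is
  finite only if such \<open>r\<close> stay away from 1.  The same argument shows
  \<open>M_inf g r * (1 - r) powr \<alpha> \<longrightarrow> 0\<close> for \<open>g \<in> B_space p \<alpha>\<close>, which gives \<open>s2 \<le> s1\<close>.  For the other
  inequality, \<open>f\<close> is approximated by its dilations \<open>f (R x)\<close> with \<open>R < 1\<close>, which are bounded.\<close>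

section \<open>Partial derivatives and the second derivative test\<close>

lemma differentiable_has_partial_deriv:
  fixes f :: "real^'n \<Rightarrow> real"
  assumes "f differentiable (at x)"
  shows "((\<lambda>t. f (x + t *\<^sub>R axis i 1)) has_real_derivative partial_deriv i f x) (at 0)"
proof -
  have f: "(f has_derivative frechet_derivative f (at x)) (at (x + 0 *\<^sub>R axis i 1))"
    using assms frechet_derivative_works by auto
  have "((\<lambda>t. x + t *\<^sub>R axis i (1::real)) has_derivative (\<lambda>t. t *\<^sub>R axis i 1)) (at 0)"
    by (auto intro!: derivative_eq_intros)
  from has_derivative_compose[OF this f]
  have "((\<lambda>t. f (x + t *\<^sub>R axis i 1)) has_derivative
          (\<lambda>t. frechet_derivative f (at x) (t *\<^sub>R axis i 1))) (at 0)" .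
  moreover have "linear (frechet_derivative f (at x))"
    using assms linear_frechet_derivative by blast
  ultimately show ?thesis
    by (simp add: has_field_derivative_def partial_deriv_def linear_cmul mult_commute_abs)
qed

lemma has_derivative_imp_partial_deriv:
  assumes "(f has_derivative f') (at x)"
  shows "partial_deriv i f x = f' (axis i 1)"
  unfolding partial_deriv_def using frechet_derivative_at[OF assms] by simp

text \<open>At the maximum \<open>g' 0 = 0\<close>. If \<open>D > 0\<close>, then \<open>g'\<close>
  is positive just to the right of 0, and by the mean value theorem \<open>g\<close> exceeds
  \<open>g 0\<close> there.\<close>

lemma second_deriv_nonpos_at_local_max:
  fixes g g' :: "real \<Rightarrow> real"
  assumes "e > 0"
    and g: "\<And>t. \<bar>t\<bar> < e \<Longrightarrow> (g has_real_derivative g' t) (at t)"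
    and g': "(g' has_real_derivative D) (at 0)"
    and max: "\<And>t. \<bar>t\<bar> < e \<Longrightarrow> g t \<le> g 0"
  shows "D \<le> 0"
proof (rule ccontr)
  assume "\<not> D \<le> 0"
  have g'0: "g' 0 = 0"
    using DERIV_local_max[OF g[of 0] \<open>e > 0\<close>] max \<open>e > 0\<close> by auto
  obtain d where d: "d > 0" "\<And>h. 0 < h \<Longrightarrow> h < d \<Longrightarrow> g' 0 < g' (0 + h)"
    using DERIV_pos_inc_right[OF g'] \<open>\<not> D \<le> 0\<close> by (meson not_le)
  define h where "h = min d e / 2"
  have h: "0 < h" "h < d" "h < e" using d(1) \<open>e > 0\<close> by (auto simp: h_def)
  have "(g has_real_derivative g' t) (at t)" if "0 \<le> t" "t \<le> h" for t
    using g that h by simp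
  then obtain z where z: "0 < z" "z < h" "g h - g 0 = (h - 0) * g' z"
    using MVT2[OF h(1), of g g'] by blast
  then have "0 < (h - 0) * g' z" using d(2)[of z] g'0 h by simp
  moreover have "g h \<le> g 0" using max[of h] h by simp
  ultimately show False using z(3) by simp
qed

lemma C2_on_imp_differentiable:
  assumes "C2_on S f" "open S" "x \<in> S"
  shows "f differentiable (at x)" "partial_deriv i f differentiable (at x)"
  using assms unfolding C2_on_def differentiable_on_def by (metis at_within_open)+

text \<open>The one-variable test on each coordinate line through \<open>x\<close> makes every
  summand of the Laplacian nonpositive.\<close>

lemma laplacian_nonpos_at_local_max:
  fixes f :: "real^'n \<Rightarrow> real"
  assumes C2: "C2_on S f" and S: "open S" "x \<in> S"
    and max: "\<And>y. y \<in> S \<Longrightarrow> f y \<le> f x"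
  shows "laplacian f x \<le> 0"
  unfolding laplacian_def
proof (rule sum_nonpos)
  fix i :: 'n
  obtain e where e: "e > 0" "ball x e \<subseteq> S" using S openE by blast
  have line: "x + t *\<^sub>R axis i 1 \<in> S" if "\<bar>t\<bar> < e" for t
    using that e(2) by (auto simp: dist_norm subset_iff)
  show "partial_deriv i (partial_deriv i f) x \<le> 0"
  proof (rule second_deriv_nonpos_at_local_max[OF e(1),
        where g = "\<lambda>t. f (x + t *\<^sub>R axis i 1)" and g' = "\<lambda>t. partial_deriv i f (x + t *\<^sub>R axis i 1)"])
    show "((\<lambda>t. partial_deriv i f (x + t *\<^sub>R axis i 1)) has_real_derivative
        partial_deriv i (partial_deriv i f) x) (at 0)"
      by (intro differentiable_has_partial_deriv C2_on_imp_differentiable[OF C2 S])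
    fix t assume t: "\<bar>t\<bar> < e"
    show "f (x + t *\<^sub>R axis i 1) \<le> f (x + 0 *\<^sub>R axis i 1)" using max line[OF t] by simp
    \<comment> \<open>The derivative along the line at parameter \<open>t\<close> is the one at
      parameter 0 for the base point moved by \<open>t\<close>.\<close>
    have "((\<lambda>u. f ((x + t *\<^sub>R axis i 1) + u *\<^sub>R axis i 1)) has_real_derivative
        partial_deriv i f (x + t *\<^sub>R axis i 1)) (at 0)"
      by (intro differentiable_has_partial_deriv C2_on_imp_differentiable[OF C2 S(1)] line t)
    then show "((\<lambda>t. f (x + t *\<^sub>R axis i 1)) has_real_derivative
        partial_deriv i f (x + t *\<^sub>R axis i 1)) (at t)"
      using DERIV_shift[of "\<lambda>t. f (x + t *\<^sub>R axis i 1)" _ 0 t] by (simp add: algebra_simps)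
  qed
qed

section \<open>Calculus of dilated functions\<close>

lemma partial_deriv_cong:
  assumes "open S" "x \<in> S" "\<And>y. y \<in> S \<Longrightarrow> f y = g y"
  shows "partial_deriv i f x = partial_deriv i g x"
proof -
  \<comment> \<open>\<open>frechet_derivative\<close> is a choice among all derivatives. Both
    functions have the same candidates, so the choices agree even at points where no derivative
    exists.\<close>
  have "(f has_derivative f') (at x) \<longleftrightarrow> (g has_derivative f') (at x)" for f'
    using assms has_derivative_transform_within_open by metis
  then show ?thesis unfolding partial_deriv_def frechet_derivative_def by simp
qed

lemma differentiable_cong_open:
  assumes "open S" "x \<in> S" "\<And>y. y \<in> S \<Longrightarrow> f y = g y" "g differentiable (at x)"
  shows "f differentiable (at x)"
proof -
  obtain g' where "(g has_derivative g') (at x)" using assms(4) unfolding differentiable_def by blast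
  then have "(f has_derivative g') (at x)"
    by (rule has_derivative_transform_within_open[OF _ assms(1,2)]) (use assms(3) in simp)
  then show ?thesis unfolding differentiable_def by blast
qed

text \<open>Affine combinations of \<open>f (R x)\<close> and \<open>|x|\<^sup>2\<close> cover both the dilations of a harmonic
  function and its negative, and the strictly subharmonic perturbation in the maximum principle.\<close>

lemma
  fixes f :: "real^'n \<Rightarrow> real"
  assumes C2: "C2_on S f" and S: "open S" and T: "open T" "\<And>x. x \<in> T \<Longrightarrow> R *\<^sub>R x \<in> S"
  shows C2_on_dilation: "C2_on T (\<lambda>x. a * f (R *\<^sub>R x) + d * (x \<bullet> x))" (is "C2_on T ?g")
    and laplacian_dilation: "x \<in> T \<Longrightarrow>
      laplacian (\<lambda>x. a * f (R *\<^sub>R x) + d * (x \<bullet> x)) x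
        = a * R\<^sup>2 * laplacian f (R *\<^sub>R x) + 2 * d * real CARD('n)"
proof -
  have comp: "((\<lambda>x. k (R *\<^sub>R x)) has_derivative (\<lambda>h. frechet_derivative k (at (R *\<^sub>R x)) (R *\<^sub>R h))) (at x)"
    if "k differentiable (at (R *\<^sub>R x))" for k :: "real^'n \<Rightarrow> real" and x
    using has_derivative_compose[OF has_derivative_scaleR_right[OF has_derivative_ident]
        that[unfolded frechet_derivative_works]] .
  have lin: "frechet_derivative k (at y) (R *\<^sub>R axis i 1) = R * partial_deriv i k y"
    if "k differentiable (at y)" for k :: "real^'n \<Rightarrow> real" and y i
    using linear_frechet_derivative[OF that] by (simp add: linear_cmul partial_deriv_def)
  note diff = C2_on_imp_differentiable[OF C2 S T(2)]
  have g: "(?g has_derivative (\<lambda>h. a * frechet_derivative f (at (R *\<^sub>R x)) (R *\<^sub>R h) + d * (2 * (x \<bullet> h)))) (at x)"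
    if "x \<in> T" for x
    by (auto intro!: derivative_eq_intros comp diff that simp: inner_commute)
  have dg: "partial_deriv i ?g x = (a * R) * partial_deriv i f (R *\<^sub>R x) + 2 * d * x $ i" if "x \<in> T" for x i
    by (simp add: has_derivative_imp_partial_deriv[OF g[OF that]] lin diff that inner_axis)
  have dg': "((\<lambda>x. (a * R) * partial_deriv i f (R *\<^sub>R x) + 2 * d * x $ i) has_derivative
      (\<lambda>h. (a * R) * frechet_derivative (partial_deriv i f) (at (R *\<^sub>R x)) (R *\<^sub>R h) + 2 * d * h $ i)) (at x)"
    if "x \<in> T" for x i
    by (auto intro!: derivative_eq_intros comp diff that bounded_linear_imp_has_derivative bounded_linear_vec_nth)
  have ddg: "partial_deriv j (partial_deriv i ?g) x
      = a * R\<^sup>2 * partial_deriv j (partial_deriv i f) (R *\<^sub>R x) + (if i = j then 2 * d else 0)"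
    if "x \<in> T" for x i j
  proof -
    \<comment> \<open>The formula \<open>dg\<close> is known on \<open>T\<close> only; since
      \<open>T\<close> is open, it may still be differentiated there.\<close>
    have "partial_deriv j (partial_deriv i ?g) x
        = partial_deriv j (\<lambda>x. (a * R) * partial_deriv i f (R *\<^sub>R x) + 2 * d * x $ i) x"
      by (rule partial_deriv_cong[OF T(1) that dg])
    also have "\<dots> = a * R\<^sup>2 * partial_deriv j (partial_deriv i f) (R *\<^sub>R x) + (if i = j then 2 * d else 0)"
    proof -
      have "(axis j 1 :: real^'n) $ i = (if i = j then 1 else 0)" by (simp add: axis_def)
      then show ?thesis
        by (simp add: has_derivative_imp_partial_deriv[OF dg'[OF that]] lin diff that power2_eq_square)
    qed
    finally show ?thesis .
  qed
  show "laplacian ?g x = a * R\<^sup>2 * laplacian f (R *\<^sub>R x) + 2 * d * real CARD('n)" if "x \<in> T" for x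
    by (simp add: laplacian_def ddg[OF that] sum.distrib sum_distrib_left)
  have "continuous_on T (\<lambda>x. partial_deriv i (partial_deriv j f) (R *\<^sub>R x))" for i j
  proof (rule continuous_on_compose2[of S _ T "\<lambda>x. R *\<^sub>R x"])
    show "continuous_on S (partial_deriv i (partial_deriv j f))" using C2 by (simp add: C2_on_def)
  qed (use T(2) in \<open>auto intro: continuous_on_scaleR continuous_on_const continuous_on_id\<close>)
  then have "continuous_on T (\<lambda>x. a * R\<^sup>2 * partial_deriv i (partial_deriv j f) (R *\<^sub>R x)
      + (if j = i then 2 * d else 0))" for i j
    by (intro continuous_on_add continuous_on_mult_left continuous_on_const)
  then have "continuous_on T (partial_deriv i (partial_deriv j ?g))" for i j
    by (subst continuous_on_cong[OF refl ddg])
  moreover have "partial_deriv i ?g differentiable (at x)" if "x \<in> T" for x i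
    using dg'[OF that] by (intro differentiable_cong_open[OF T(1) that dg]) (auto simp: differentiable_def)
  moreover have "?g differentiable (at x)" if "x \<in> T" for x
    using g[OF that] by (auto simp: differentiable_def)
  ultimately show "C2_on T ?g"
    unfolding C2_on_def differentiable_on_def by (auto intro: differentiable_at_withinI)
qed

lemma harmonic_on_dilation:
  fixes f :: "real^'n \<Rightarrow> real"
  assumes "harmonic_on (ball 0 1) f" "\<bar>R\<bar> \<le> 1"
  shows "harmonic_on (ball 0 1) (\<lambda>x. a * f (R *\<^sub>R x))"
proof -
  have "R *\<^sub>R x \<in> ball 0 1" if "x \<in> ball 0 1" for x :: "real^'n"
    using that assms(2) mult_left_le_one_le[of "norm x" "\<bar>R\<bar>"] by simp
  then show ?thesis
    using assms(1) C2_on_dilation[of "ball 0 1" f "ball 0 1" R a 0] 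
      laplacian_dilation[of "ball 0 1" f "ball 0 1" R _ a 0]
    by (simp add: harmonic_on_def)
qed

section \<open>Maximum principle and monotonicity of \<open>M_inf\<close>\<close>

lemma harmonic_on_imp_continuous_on:
  "harmonic_on S f \<Longrightarrow> continuous_on S f"
  unfolding harmonic_on_def C2_on_def by (auto intro: differentiable_imp_continuous_on)

text \<open>Adding \<open>d * (x \<bullet> x)\<close> makes the Laplacian strictly positive, so the
  maximum over \<open>cball 0 r\<close> cannot lie in the interior. On the sphere the perturbation
  costs at most \<open>d\<close>, which is arbitrary.\<close>

lemma harmonic_max_principle:
  fixes f :: "real^'n \<Rightarrow> real"
  assumes f: "harmonic_on (ball 0 1) f" and r: "0 \<le> r" "r < 1"
    and le: "\<And>y. norm y = r \<Longrightarrow> f y \<le> K" and x: "norm x \<le> r"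
  shows "f x \<le> K"
proof (rule field_le_epsilon)
  fix d :: real assume d: "d > 0"
  let ?g = "\<lambda>x. 1 * f (1 *\<^sub>R x) + d * (x \<bullet> x)"
  have C2: "C2_on (ball 0 1) f" using f by (simp add: harmonic_on_def)
  have sub: "cball 0 r \<subseteq> ball 0 1" using r by auto
  have "continuous_on (cball 0 r) f"
    using harmonic_on_imp_continuous_on[OF f] sub continuous_on_subset by blast
  then have "continuous_on (cball 0 r) ?g" by (auto intro!: continuous_intros)
  moreover have "cball (0::real^'n) r \<noteq> {}" using r by simp
  ultimately obtain z where z: "z \<in> cball 0 r" "\<And>y. y \<in> cball 0 r \<Longrightarrow> ?g y \<le> ?g z"
    using continuous_attains_sup[OF compact_cball] by meson
  have "norm z = r"
  proof (rule ccontr)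
    assume "norm z \<noteq> r"
    then have zr: "z \<in> ball 0 r" using z(1) by simp
    have "C2_on (ball 0 r) ?g"
      using r by (intro C2_on_dilation[OF C2]) auto
    then have "laplacian ?g z \<le> 0"
      by (rule laplacian_nonpos_at_local_max) (use zr z(2) in auto)
    moreover have "laplacian ?g z = laplacian f z + 2 * d * real CARD('n)"
      using laplacian_dilation[OF C2, of "ball 0 r" 1 z 1 d] zr r by auto
    moreover have "laplacian f z = 0"
      using f zr r by (simp add: harmonic_on_def)
    ultimately show False using d by (simp add: mult_le_0_iff)
  qed
  have "f x \<le> ?g x" using d by simp
  also have "\<dots> \<le> ?g z" using z(2) x by simp
  also have "\<dots> \<le> K + d * 1"
  proof -
    have "r\<^sup>2 \<le> 1" using r by (simp add: power_le_one)
    then have "z \<bullet> z \<le> 1" by (simp add: dot_square_norm \<open>norm z = r\<close>)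
    then show ?thesis using le[OF \<open>norm z = r\<close>] d by (intro add_mono mult_left_mono) auto
  qed
  finally show "f x \<le> K + d" by simp
qed

lemma sphere_nonempty: "sphere (0::real^'n) 1 \<noteq> {}"
proof -
  obtain u :: "real^'n" where "norm u = 1" using vector_choose_size[of 1] zero_le_one by blast
  then have "u \<in> sphere 0 1" by simp
  then show ?thesis by blast
qed

lemma bdd_above_M_inf:
  fixes f :: "real^'n \<Rightarrow> real"
  assumes "continuous_on (ball 0 1) f" "0 \<le> r" "r < 1"
  shows "bdd_above ((\<lambda>x'. \<bar>f (r *\<^sub>R x')\<bar>) ` sphere 0 1)"
proof (intro bounded_imp_bdd_above compact_imp_bounded compact_continuous_image)
  show "continuous_on (sphere 0 1) (\<lambda>x'. \<bar>f (r *\<^sub>R x')\<bar>)"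
  proof (rule continuous_on_rabs, rule continuous_on_compose2[OF assms(1)])
    show "continuous_on (sphere 0 1 :: (real^'n) set) (\<lambda>x'. r *\<^sub>R x')"
      by (rule linear_continuous_on[OF bounded_linear_scaleR_right])
  qed (use assms(2,3) in auto)
qed (rule compact_sphere)

text \<open>The maximum principle is applied to \<open>f\<close> and to \<open>- f\<close>. Allowing
  every \<open>x\<close> with \<open>norm x \<le> r\<close>, and not just the sphere, is what makes
  \<open>M_inf f\<close> increasing and controls dilations.\<close>

lemma abs_le_M_inf:
  fixes f :: "real^'n \<Rightarrow> real"
  assumes f: "harmonic_on (ball 0 1) f" and x: "norm x \<le> r" and r: "r < 1"
  shows "\<bar>f x\<bar> \<le> M_inf f r"
proof -
  have r0: "0 \<le> r" using x norm_ge_zero order_trans by blast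
  have sph: "\<bar>f y\<bar> \<le> M_inf f r" if y: "norm y = r" for y
  proof (cases "r = 0")
    \<comment> \<open>Here \<open>y\<close> cannot be rescaled to a unit vector, but
      \<open>y\<close> and \<open>r *\<^sub>R u\<close> are both 0, so any unit vector
      \<open>u\<close> serves.\<close>
    case True
    obtain u :: "real^'n" where "u \<in> sphere 0 1" using sphere_nonempty by blast
    then show ?thesis
      using True y cSUP_upper[OF _ bdd_above_M_inf[OF harmonic_on_imp_continuous_on[OF f] r0 r], of u]
      by (simp add: M_inf_def)
  next
    case False
    then show ?thesis
      using y r0 cSUP_upper[OF _ bdd_above_M_inf[OF harmonic_on_imp_continuous_on[OF f] r0 r], of "y /\<^sub>R r"]
      by (simp add: M_inf_def)
  qed
  have "harmonic_on (ball 0 1) (\<lambda>x. - f x)"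
    using harmonic_on_dilation[OF f, of 1 "-1"] by simp
  then have "- f x \<le> M_inf f r"
    by (rule harmonic_max_principle[OF _ r0 r _ x]) (use sph in force)
  moreover have "f x \<le> M_inf f r"
    by (rule harmonic_max_principle[OF f r0 r _ x]) (use sph in force)
  ultimately show ?thesis by simp
qed

lemma M_inf_leI:
  fixes f :: "real^'n \<Rightarrow> real"
  assumes "0 \<le> r" "\<And>x. norm x = r \<Longrightarrow> \<bar>f x\<bar> \<le> K"
  shows "M_inf f r \<le> K"
  unfolding M_inf_def by (rule cSUP_least[OF sphere_nonempty]) (use assms in auto)

lemma M_inf_mono:
  fixes f :: "real^'n \<Rightarrow> real"
  assumes "harmonic_on (ball 0 1) f" "0 \<le> r" "r \<le> s" "s < 1"
  shows "M_inf f r \<le> M_inf f s"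
  using assms by (intro M_inf_leI abs_le_M_inf) auto

lemma M_inf_nonneg:
  fixes f :: "real^'n \<Rightarrow> real"
  assumes "harmonic_on (ball 0 1) f" "0 \<le> r" "r < 1"
  shows "0 \<le> M_inf f r"
  using abs_le_M_inf[OF assms(1), of 0 r] assms by simp

section \<open>Convergence and divergence of integrals near 1\<close>

lemma nn_integral_powr_finite:
  assumes "a > -1"
  shows "(\<integral>\<^sup>+r\<in>{0..<1}. ennreal ((1 - r) powr a) \<partial>lborel) < \<infinity>"
proof -
  have "((\<lambda>x. if x \<in> {0..1} then x powr a else 0) has_integral (1 / (a + 1))) UNIV"
    using has_integral_powr_from_0[of a 1] assms
    by (subst has_integral_restrict_UNIV) auto
  then have I: "(\<integral>\<^sup>+x. ennreal (if x \<in> {0..1} then x powr a else 0) \<partial>lborel) = ennreal (1 / (a + 1))"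
    by (intro nn_integral_has_integral_lborel) auto
  \<comment> \<open>Writing \<open>1 - r\<close> as \<open>1 + (-1) * r\<close> prepares the affine
    substitution that moves the singularity from 1 to 0.\<close>
  have "(\<integral>\<^sup>+r\<in>{0..<1}. ennreal ((1 - r) powr a) \<partial>lborel)
      \<le> (\<integral>\<^sup>+r. ennreal (if 1 + (-1) * r \<in> {0..1} then (1 + (-1) * r) powr a else 0) \<partial>lborel)"
    by (intro nn_integral_mono) (auto simp: indicator_def)
  also have "\<dots> = ennreal (1 / (a + 1))"
    using nn_integral_real_affine[of "\<lambda>x. ennreal (if x \<in> {0..1} then x powr a else 0)" "-1" 1] I
    by simp
  finally show ?thesis by (rule le_less_trans) simp
qed

text \<open>The dyadic intervals \<open>[r, (1 + r) / 2]\<close> have equal mass under \<open>dr / (1 - r)\<close>; infinitely many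
  of them are disjoint.\<close>

lemma nn_integral_eq_top_if_frequently_ge:
  fixes H :: "real \<Rightarrow> ennreal"
  assumes c: "c > 0"
    and H: "\<And>s. 0 \<le> s \<Longrightarrow> s < 1 \<Longrightarrow>
      \<exists>r\<ge>s. r < 1 \<and> (\<forall>\<rho>\<in>{r..(1 + r) / 2}. ennreal (c / (1 - r)) \<le> H \<rho>)"
  shows "(\<integral>\<^sup>+\<rho>\<in>{0..<1}. H \<rho> \<partial>lborel) = \<infinity>"
proof -
  \<comment> \<open>\<open>H\<close> is not known to be measurable, so its integral cannot be split
    over disjoint pieces. Instead measurable minorants \<open>G\<close>, vanishing outside
    \<open>{0..<s}\<close>, are built up; each new interval adds \<open>c / 2\<close> to their
    integral.\<close>
  have step: "\<exists>s G. 0 \<le> s \<and> s < 1 \<and> G \<in> borel_measurable lborel \<and>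
      (\<forall>\<rho>. G \<rho> \<le> H \<rho> * indicator {0..<s} \<rho>) \<and> ennreal (real N * (c / 2)) \<le> (\<integral>\<^sup>+\<rho>. G \<rho> \<partial>lborel)" for N
  proof (induction N)
    case 0
    show ?case by (intro exI[of _ 0] exI[of _ "\<lambda>_. 0"]) auto
  next
    case (Suc N)
    then obtain s G where s: "0 \<le> s" "s < 1" and [measurable]: "G \<in> borel_measurable lborel"
      and G: "\<And>\<rho>. G \<rho> \<le> H \<rho> * indicator {0..<s} \<rho>"
      and I: "ennreal (real N * (c / 2)) \<le> (\<integral>\<^sup>+\<rho>. G \<rho> \<partial>lborel)"
      by blast
    obtain r where r: "r \<ge> s" "r < 1"
      and Hr: "\<And>\<rho>. \<rho> \<in> {r..(1 + r) / 2} \<Longrightarrow> ennreal (c / (1 - r)) \<le> H \<rho>"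
      using H[OF s] by blast
    \<comment> \<open>The right end is left out so that \<open>J\<close> lies in
      \<open>{0..<(1 + r) / 2}\<close>, the support bound of the next stage; as
      \<open>r \<ge> s\<close>, the old \<open>G\<close> vanishes on \<open>J\<close>.\<close>
    define J where "J = {r..<(1 + r) / 2}"
    define G' where "G' = (\<lambda>\<rho>. G \<rho> + ennreal (c / (1 - r)) * indicator J \<rho>)"
    have J [measurable]: "J \<in> sets lborel" by (simp add: J_def)
    have "G' \<rho> \<le> H \<rho> * indicator {0..<(1 + r) / 2} \<rho>" for \<rho>
    proof (cases "\<rho> \<in> J")
      case True
      then have "G \<rho> = 0" using G[of \<rho>] r by (simp add: J_def)
      then show ?thesis using True Hr[of \<rho>] r s by (simp add: G'_def J_def)
    next
      case False
      then have "G' \<rho> \<le> H \<rho> * indicator {0..<s} \<rho>" using G by (simp add: G'_def)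
      also have "\<dots> \<le> H \<rho> * indicator {0..<(1 + r) / 2} \<rho>"
        using r by (intro mult_left_mono) (auto simp: indicator_def)
      finally show ?thesis .
    qed
    moreover have "ennreal (real (Suc N) * (c / 2)) \<le> (\<integral>\<^sup>+\<rho>. G' \<rho> \<partial>lborel)"
    proof -
      have "(\<integral>\<^sup>+\<rho>. G' \<rho> \<partial>lborel) = (\<integral>\<^sup>+\<rho>. G \<rho> \<partial>lborel) + ennreal (c / (1 - r)) * emeasure lborel J"
        by (simp add: G'_def nn_integral_add nn_integral_cmult_indicator[OF J])
      also have "emeasure lborel J = ennreal ((1 - r) / 2)"
        using r by (simp add: J_def field_simps)
      also have "ennreal (c / (1 - r)) * ennreal ((1 - r) / 2) = ennreal (c / 2)"
        using r c by (simp add: ennreal_mult[symmetric])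
      finally have "(\<integral>\<^sup>+\<rho>. G' \<rho> \<partial>lborel) = (\<integral>\<^sup>+\<rho>. G \<rho> \<partial>lborel) + ennreal (c / 2)" .
      moreover have "ennreal (real (Suc N) * (c / 2)) = ennreal (real N * (c / 2)) + ennreal (c / 2)"
        using c by (subst ennreal_plus[symmetric]) (auto simp: field_simps)
      ultimately show ?thesis using I by (simp add: add_right_mono)
    qed
    moreover have "G' \<in> borel_measurable lborel" unfolding G'_def by measurable
    ultimately show ?case using r s by (intro exI[of _ "(1 + r) / 2"] exI[of _ G']) auto
  qed
  have ge: "ennreal (real N * (c / 2)) \<le> (\<integral>\<^sup>+\<rho>\<in>{0..<1}. H \<rho> \<partial>lborel)" for N
  proof -
    obtain s G where s: "0 \<le> s" "s < 1"
      and G: "\<And>\<rho>. G \<rho> \<le> H \<rho> * indicator {0..<s} \<rho>"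
      and I: "ennreal (real N * (c / 2)) \<le> (\<integral>\<^sup>+\<rho>. G \<rho> \<partial>lborel)"
      using step[of N] by blast
    have "G \<rho> \<le> H \<rho> * indicator {0..<1} \<rho>" for \<rho>
      by (rule order_trans[OF G]) (use s in \<open>auto intro!: mult_left_mono simp: indicator_def\<close>)
    then have "(\<integral>\<^sup>+\<rho>. G \<rho> \<partial>lborel) \<le> (\<integral>\<^sup>+\<rho>\<in>{0..<1}. H \<rho> \<partial>lborel)"
      by (rule nn_integral_mono)
    with I show ?thesis by (rule order_trans)
  qed
  show ?thesis
  proof (rule ccontr)
    assume "\<not> ?thesis"
    then obtain v where v: "0 \<le> v" "(\<integral>\<^sup>+\<rho>\<in>{0..<1}. H \<rho> \<partial>lborel) = ennreal v"
      by (cases "\<integral>\<^sup>+\<rho>\<in>{0..<1}. H \<rho> \<partial>lborel") auto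
    obtain N where N: "v / (c / 2) < real N" using reals_Archimedean2 by blast
    have "real N * (c / 2) \<le> v"
      using ge[of N] v by simp
    then show False using N c by (simp add: field_simps)
  qed
qed

section \<open>Decay of \<open>M_inf\<close> forced by finite integrals\<close>

lemma ennpow_less_top: "x < top \<Longrightarrow> ennpow x p < top"
  by (simp add: ennpow_def)

lemma ennpow_ennreal: "0 \<le> x \<Longrightarrow> ennpow (ennreal x) p = ennreal (x powr p)"
  by (simp add: ennpow_def)

lemma ennpow_mono:
  assumes "x \<le> y" "0 \<le> p"
  shows "ennpow x p \<le> ennpow y p"
proof (cases "y = \<infinity>")
  case False
  then have "x < \<infinity>" "y < \<infinity>" using assms(1) by (auto simp: top.not_eq_extremum intro: le_less_trans)
  then show ?thesis
    using assms by (auto simp: ennpow_def intro!: ennreal_leI powr_mono2 enn2real_mono)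
qed (simp add: ennpow_def)

text \<open>Up to the midpoint of \<open>r\<close> and 1 the distance to 1 at most halves. This is
  the source of every factor \<open>2 powr (- \<alpha>)\<close> below.\<close>

lemma powr_half_le:
  fixes r t a :: real
  assumes "t \<le> (1 + r) / 2" "r < 1" "0 \<le> a"
  shows "(1 - r) powr a * 2 powr (- a) \<le> (1 - t) powr a"
proof -
  have "((1 - r) / 2) powr a \<le> (1 - t) powr a"
    using assms by (intro powr_mono2) auto
  also have "((1 - r) / 2) powr a = (1 - r) powr a * 2 powr (- a)"
    using powr_divide[of "1 - r" 2 a] by (simp add: powr_minus_divide)
  finally show ?thesis .
qed

text \<open>The integrand is \<open>(M_inf g \<rho> * (1 - \<rho>) powr \<alpha>) powr p / (1 -
  \<rho>)\<close>. As \<open>M_inf g\<close> increases, a value \<open>\<ge> \<eta>\<close> of the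
  weighted maximum at \<open>r\<close> persists on \<open>[r, (1 + r) / 2]\<close> up to
  \<open>2 powr (- \<alpha>)\<close>, so the integrand is at least \<open>c / (1 - r)\<close> there.
  If this recurs near 1, the integral diverges.\<close>

lemma B_space_M_inf_eventually_less:
  fixes g :: "real^'n \<Rightarrow> real"
  assumes \<alpha>: "\<alpha> > 0" and p: "p > 0" and g: "g \<in> B_space p \<alpha>" and \<eta>: "\<eta> > 0"
  shows "\<exists>s\<ge>0. s < 1 \<and> (\<forall>r\<ge>s. r < 1 \<longrightarrow> M_inf g r * (1 - r) powr \<alpha> < \<eta>)"
proof (rule ccontr)
  assume contra: "\<not> ?thesis"
  have harm: "harmonic_on (ball 0 1) g" and fin: "B_norm p \<alpha> g < \<infinity>"
    using g by (auto simp: B_space_def)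
  define c where "c = (\<eta> * 2 powr (- \<alpha>)) powr p"
  have "(\<integral>\<^sup>+r\<in>{0..<1}. ennreal (M_inf g r powr p * (1 - r) powr (\<alpha> * p - 1)) \<partial>lborel) = \<infinity>"
  proof (rule nn_integral_eq_top_if_frequently_ge[of c])
    show "c > 0" using \<eta> by (simp add: c_def)
    fix s :: real assume s: "0 \<le> s" "s < 1"
    then obtain r where r: "r \<ge> s" "r < 1" "\<eta> \<le> M_inf g r * (1 - r) powr \<alpha>"
      using contra by (meson not_less)
    have "c / (1 - r) \<le> M_inf g \<rho> powr p * (1 - \<rho>) powr (\<alpha> * p - 1)" if \<rho>: "r \<le> \<rho>" "\<rho> \<le> (1 + r) / 2" for \<rho>
    proof -
      have \<rho>1: "\<rho> < 1" using \<rho> r by simp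
      have "\<eta> * 2 powr (- \<alpha>) \<le> M_inf g r * ((1 - r) powr \<alpha> * 2 powr (- \<alpha>))"
        using r(3) by (simp add: mult.assoc[symmetric] mult_right_mono)
      also have "\<dots> \<le> M_inf g \<rho> * (1 - \<rho>) powr \<alpha>"
        using \<rho> \<rho>1 r s \<alpha> M_inf_nonneg[OF harm]
        by (intro mult_mono M_inf_mono[OF harm] powr_half_le) auto
      finally have "c \<le> (M_inf g \<rho> * (1 - \<rho>) powr \<alpha>) powr p"
        unfolding c_def using \<eta> p by (intro powr_mono2) auto
      also have "\<dots> = M_inf g \<rho> powr p * (1 - \<rho>) powr (\<alpha> * p)"
        using M_inf_nonneg[OF harm, of \<rho>] \<rho> \<rho>1 r s by (simp add: powr_mult powr_powr)
      finally have "c / (1 - r) \<le> M_inf g \<rho> powr p * (1 - \<rho>) powr (\<alpha> * p) / (1 - \<rho>)"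
        using \<rho> \<rho>1 by (intro frac_le) (auto simp: c_def)
      then show ?thesis using \<rho>1 by (simp add: powr_diff)
    qed
    then show "\<exists>r\<ge>s. r < 1 \<and> (\<forall>\<rho>\<in>{r..(1 + r) / 2}.
        ennreal (c / (1 - r)) \<le> ennreal (M_inf g \<rho> powr p * (1 - \<rho>) powr (\<alpha> * p - 1)))"
      using r by (intro exI[of _ r]) (auto intro!: ennreal_leI)
  qed
  then show False using fin by (simp add: B_norm_def ennpow_def)
qed

lemma L_integral_finite_imp_M_inf_eventually_less:
  fixes f :: "real^'n \<Rightarrow> real"
  assumes \<alpha>: "\<alpha> > 0" and p: "p > 0" and harm: "harmonic_on (ball 0 1) f"
    and fin: "L_integral p \<alpha> \<epsilon> f < \<infinity>"
  shows "\<exists>s\<ge>0. s < 1 \<and> (\<forall>r\<ge>s. r < 1 \<longrightarrow> M_inf f r * (1 - r) powr \<alpha> < 2 powr \<alpha> * \<epsilon>)"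
proof (rule ccontr)
  assume contra: "\<not> ?thesis"
  \<comment> \<open>The first factor comes from the kernel bound
    \<open>1 / (2 * (1 - r)) powr (\<alpha> + 1)\<close> times the interval length
    \<open>(1 - r) / 2\<close>, which is
    \<open>2 powr (- (\<alpha> + 2)) * (1 - r) powr (- \<alpha>)\<close>. The second is the cost of
    replacing \<open>1 - r\<close> by \<open>1 - \<rho>\<close>.\<close>
  define c where "c = (2 powr (- (\<alpha> + 2)) * 2 powr (- \<alpha>)) powr p"
  let ?I = "\<lambda>\<rho>. \<integral>\<^sup>+r\<in>L_hat \<epsilon> \<alpha> f. ennreal (1 / (1 - r * \<rho>) powr (\<alpha> + 1)) \<partial>lborel"
  have "L_integral p \<alpha> \<epsilon> f = \<infinity>"
    unfolding L_integral_def
  proof (rule nn_integral_eq_top_if_frequently_ge[of c])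
    show "c > 0" by (simp add: c_def)
    fix s :: real assume s: "0 \<le> s" "s < 1"
    then obtain r where r: "r \<ge> s" "r < 1" "2 powr \<alpha> * \<epsilon> \<le> M_inf f r * (1 - r) powr \<alpha>"
      using contra by (meson not_less)
    \<comment> \<open>The factor \<open>2 powr \<alpha>\<close> in the threshold pays for the loss
      in the weight between \<open>r\<close> and the midpoint.\<close>
    have sub: "t \<in> L_hat \<epsilon> \<alpha> f" if t: "r \<le> t" "t \<le> (1 + r) / 2" for t
    proof -
      have t1: "t < 1" using t r by simp
      have "\<epsilon> = 2 powr \<alpha> * \<epsilon> * 2 powr (- \<alpha>)" by (simp add: powr_minus)
      also have "\<dots> \<le> M_inf f r * ((1 - r) powr \<alpha> * 2 powr (- \<alpha>))"
        using mult_right_mono[OF r(3), of "2 powr (- \<alpha>)"] by (simp add: mult.assoc)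
      also have "\<dots> \<le> M_inf f t * (1 - t) powr \<alpha>"
        using t t1 r s \<alpha> M_inf_nonneg[OF harm]
        by (intro mult_mono M_inf_mono[OF harm] powr_half_le) auto
      finally show ?thesis using t t1 r s by (simp add: L_hat_def)
    qed
    have "ennreal (c / (1 - r)) \<le> ennpow (?I \<rho>) p * ennreal ((1 - \<rho>) powr (\<alpha> * p - 1))"
      if \<rho>: "r \<le> \<rho>" "\<rho> \<le> (1 + r) / 2" for \<rho>
    proof -
      have \<rho>1: "\<rho> < 1" using \<rho> r by simp
      have kernel: "1 / (2 * (1 - r)) powr (\<alpha> + 1) \<le> 1 / (1 - t * \<rho>) powr (\<alpha> + 1)"
        if t: "r \<le> t" "t \<le> (1 + r) / 2" for t
      proof -
        have t1: "t < 1" using t r by simp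
        \<comment> \<open>As \<open>t\<close> and \<open>\<rho>\<close> are both at least
          \<open>r\<close>, \<open>1 - t * \<rho> \<le> 1 - r * r \<le> 2 * (1 - r)\<close>.\<close>
        have "r * r \<le> t * \<rho>" using t \<rho> r s by (intro mult_mono) auto
        moreover have "1 - r * r \<le> 2 * (1 - r)"
          using zero_le_square[of "1 - r"] by (simp add: algebra_simps)
        moreover have "t * \<rho> < 1"
          using mult_strict_mono[of t 1 \<rho> 1] t1 \<rho>1 \<rho> r s by simp
        ultimately show ?thesis
          using \<alpha> by (intro divide_left_mono powr_mono2) auto
      qed
      have "ennreal (2 powr (- (\<alpha> + 2)) * (1 - r) powr (- \<alpha>))
          = ennreal (1 / (2 * (1 - r)) powr (\<alpha> + 1) * ((1 - r) / 2))"
      proof -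
        have A: "2 powr (\<alpha> + 2) = 4 * 2 powr \<alpha>"
          by (simp only: powr_add) simp
        have B: "(2 * (1 - r)) powr (\<alpha> + 1) = 2 * (1 - r) * (2 powr \<alpha> * (1 - r) powr \<alpha>)"
          using r powr_mult[of 2 "1 - r" \<alpha>] by (simp add: powr_add)
        \<comment> \<open>Replacing the powers by variables leaves a rational identity. It survives
          \<open>x = 0\<close> or \<open>y = 0\<close>, where division by zero makes both sides
          0.\<close>
        have C: "1 / (4 * x) * (1 / y) = 1 / (2 * u * (x * y)) * (u / 2)" if "u \<noteq> 0" for x y u :: real
          using that by (simp add: divide_simps)
        show ?thesis
          unfolding powr_minus_divide A B by (rule arg_cong[where f = ennreal, OF C]) (use r in simp)
      qed
      also have "\<dots> = ennreal (1 / (2 * (1 - r)) powr (\<alpha> + 1)) * emeasure lborel {r..(1 + r) / 2}"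
        using r by (subst ennreal_mult) (auto simp: field_simps)
      also have "\<dots> = (\<integral>\<^sup>+t. ennreal (1 / (2 * (1 - r)) powr (\<alpha> + 1)) * indicator {r..(1 + r) / 2} t \<partial>lborel)"
        by (simp add: nn_integral_cmult_indicator)
      also have "\<dots> \<le> ?I \<rho>"
        using kernel sub by (intro nn_integral_mono) (auto simp: indicator_def intro!: ennreal_leI)
      finally have "ennpow (ennreal (2 powr (- (\<alpha> + 2)) * (1 - r) powr (- \<alpha>))) p \<le> ennpow (?I \<rho>) p"
        using p by (intro ennpow_mono) auto
      then have I: "ennreal ((2 powr (- (\<alpha> + 2)) * (1 - r) powr (- \<alpha>)) powr p) \<le> ennpow (?I \<rho>) p"
        by (simp add: ennpow_ennreal)
      \<comment> \<open>The growth \<open>(1 - r) powr (- \<alpha>)\<close> of the inner integral is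
        cancelled by the outer weight, leaving the scale-invariant density
        \<open>1 / (1 - \<rho>)\<close>.\<close>
      have "2 powr (- \<alpha>) \<le> (1 - r) powr (- \<alpha>) * (1 - \<rho>) powr \<alpha>"
        using powr_half_le[OF \<rho>(2) r(2), of \<alpha>] \<alpha> r(2) by (simp add: powr_minus field_simps)
      then have "c \<le> (2 powr (- (\<alpha> + 2)) * ((1 - r) powr (- \<alpha>) * (1 - \<rho>) powr \<alpha>)) powr p"
        unfolding c_def using p by (intro powr_mono2 mult_left_mono) auto
      also have "\<dots> = (2 powr (- (\<alpha> + 2)) * (1 - r) powr (- \<alpha>)) powr p * (1 - \<rho>) powr (\<alpha> * p)"
        by (simp add: powr_mult powr_powr mult.assoc)
      finally have "c / (1 - r)
          \<le> (2 powr (- (\<alpha> + 2)) * (1 - r) powr (- \<alpha>)) powr p * (1 - \<rho>) powr (\<alpha> * p) / (1 - \<rho>)"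
        using \<rho> \<rho>1 by (intro frac_le) (auto simp: c_def)
      then have "ennreal (c / (1 - r))
          \<le> ennreal ((2 powr (- (\<alpha> + 2)) * (1 - r) powr (- \<alpha>)) powr p * (1 - \<rho>) powr (\<alpha> * p - 1))"
        using \<rho>1 by (intro ennreal_leI) (simp add: powr_diff)
      also have "\<dots> \<le> ennpow (?I \<rho>) p * ennreal ((1 - \<rho>) powr (\<alpha> * p - 1))"
        using I by (subst ennreal_mult) (auto intro: mult_right_mono)
      finally show ?thesis .
    qed
    then show "\<exists>r\<ge>s. r < 1 \<and> (\<forall>\<rho>\<in>{r..(1 + r) / 2}.
        ennreal (c / (1 - r)) \<le> ennpow (?I \<rho>) p * ennreal ((1 - \<rho>) powr (\<alpha> * p - 1)))"
      using r by (intro exI[of _ r]) auto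
  qed
  then show False using fin by simp
qed

section \<open>Upper bounds for \<open>s2\<close> and \<open>s1\<close>\<close>

lemma L_integral_finite:
  fixes f :: "real^'n \<Rightarrow> real"
  assumes \<alpha>: "\<alpha> > 0" and p: "p > 0" and s: "0 \<le> s" "s < 1"
    and less: "\<And>r. s \<le> r \<Longrightarrow> r < 1 \<Longrightarrow> M_inf f r * (1 - r) powr \<alpha> < \<epsilon>"
  shows "L_integral p \<alpha> \<epsilon> f < \<infinity>"
proof -
  \<comment> \<open>By \<open>less\<close>, \<open>L_hat \<epsilon> \<alpha> f\<close> lies in
    \<open>[0, s]\<close>, where the kernel is at most \<open>K\<close> for every
    \<open>\<rho>\<close> in \<open>[0, 1)\<close>. The inner integral is thus bounded, and the
    outer weight is integrable because \<open>\<alpha> * p - 1 > -1\<close>.\<close>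
  define K where "K = 1 / (1 - s) powr (\<alpha> + 1)"
  have inner: "(\<integral>\<^sup>+r\<in>L_hat \<epsilon> \<alpha> f. ennreal (1 / (1 - r * \<rho>) powr (\<alpha> + 1)) \<partial>lborel) \<le> ennreal (K * s)"
    if \<rho>: "0 \<le> \<rho>" "\<rho> < 1" for \<rho>
  proof -
    have "(\<integral>\<^sup>+r\<in>L_hat \<epsilon> \<alpha> f. ennreal (1 / (1 - r * \<rho>) powr (\<alpha> + 1)) \<partial>lborel)
        \<le> (\<integral>\<^sup>+r. ennreal K * indicator {0..s} r \<partial>lborel)"
    proof (rule nn_integral_mono)
      fix r
      show "ennreal (1 / (1 - r * \<rho>) powr (\<alpha> + 1)) * indicator (L_hat \<epsilon> \<alpha> f) r
          \<le> ennreal K * indicator {0..s} r"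
      proof (cases "r \<in> L_hat \<epsilon> \<alpha> f")
        case True
        then have r: "0 \<le> r" "r \<le> s"
          using less[of r] by (auto simp: L_hat_def not_less[symmetric])
        then have "r * \<rho> \<le> s * 1" using \<rho> by (intro mult_mono) auto
        then have "1 / (1 - r * \<rho>) powr (\<alpha> + 1) \<le> K"
          unfolding K_def using s \<alpha> by (intro divide_left_mono powr_mono2) auto
        then show ?thesis using True r by (auto intro!: ennreal_leI)
      qed simp
    qed
    also have "\<dots> = ennreal (K * s)"
      using s by (simp add: nn_integral_cmult_indicator ennreal_mult[symmetric] K_def)
    finally show ?thesis .
  qed
  have "L_integral p \<alpha> \<epsilon> f
      \<le> (\<integral>\<^sup>+\<rho>. ennreal ((K * s) powr p) * (ennreal ((1 - \<rho>) powr (\<alpha> * p - 1)) * indicator {0..<1} \<rho>) \<partial>lborel)"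
    unfolding L_integral_def
  proof (rule nn_integral_mono)
    fix \<rho>
    let ?I = "\<integral>\<^sup>+r\<in>L_hat \<epsilon> \<alpha> f. ennreal (1 / (1 - r * \<rho>) powr (\<alpha> + 1)) \<partial>lborel"
    show "ennpow ?I p * ennreal ((1 - \<rho>) powr (\<alpha> * p - 1)) * indicator {0..<1} \<rho>
        \<le> ennreal ((K * s) powr p) * (ennreal ((1 - \<rho>) powr (\<alpha> * p - 1)) * indicator {0..<1} \<rho>)"
    proof (cases "\<rho> \<in> {0..<1}")
      case True
      have "0 \<le> K * s" using s by (simp add: K_def)
      then have "ennpow ?I p \<le> ennreal ((K * s) powr p)"
        using True ennpow_mono[OF inner, of \<rho> p] p by (simp add: ennpow_ennreal)
      then show ?thesis using True by (simp add: mult_right_mono)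
    qed simp
  qed
  also have "\<dots> = ennreal ((K * s) powr p) *
      (\<integral>\<^sup>+\<rho>\<in>{0..<1}. ennreal ((1 - \<rho>) powr (\<alpha> * p - 1)) \<partial>lborel)"
    by (rule nn_integral_cmult) measurable
  also have "\<dots> < \<infinity>"
    using nn_integral_powr_finite[of "\<alpha> * p - 1"] \<alpha> p by (simp add: ennreal_mult_less_top)
  finally show ?thesis .
qed

text \<open>The dilation is bounded on the ball by \<open>M_inf f R\<close>, so a constant multiple
  of the integrable weight dominates the integrand.\<close>

lemma dilation_in_B_space:
  fixes f :: "real^'n \<Rightarrow> real"
  assumes \<alpha>: "\<alpha> > 0" and p: "p > 0" and harm: "harmonic_on (ball 0 1) f" and R: "0 \<le> R" "R < 1"
  shows "(\<lambda>x. f (R *\<^sub>R x)) \<in> B_space p \<alpha>"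
proof -
  let ?g = "\<lambda>x. f (R *\<^sub>R x)"
  have g: "harmonic_on (ball 0 1) ?g"
    using harmonic_on_dilation[OF harm, of R 1] R by simp
  have M: "M_inf ?g r \<le> M_inf f R" if "0 \<le> r" "r < 1" for r
    using that R by (intro M_inf_leI abs_le_M_inf[OF harm]) (auto intro: mult_left_le)
  have "(\<integral>\<^sup>+r\<in>{0..<1}. ennreal (M_inf ?g r powr p * (1 - r) powr (\<alpha> * p - 1)) \<partial>lborel)
      \<le> (\<integral>\<^sup>+r. ennreal (M_inf f R powr p) * (ennreal ((1 - r) powr (\<alpha> * p - 1)) * indicator {0..<1} r) \<partial>lborel)"
    using M M_inf_nonneg[OF g] p
    by (intro nn_integral_mono)
      (auto simp: indicator_def ennreal_mult[symmetric] intro!: ennreal_leI mult_right_mono powr_mono2)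
  also have "\<dots> = ennreal (M_inf f R powr p) *
      (\<integral>\<^sup>+r\<in>{0..<1}. ennreal ((1 - r) powr (\<alpha> * p - 1)) \<partial>lborel)"
    by (rule nn_integral_cmult) measurable
  also have "\<dots> < \<infinity>"
    using nn_integral_powr_finite[of "\<alpha> * p - 1"] \<alpha> p by (simp add: ennreal_mult_less_top)
  finally show ?thesis
    unfolding B_space_def B_norm_def using g by (auto intro: ennpow_less_top)
qed

lemma dilation_uniformly_close:
  fixes f :: "real^'n \<Rightarrow> real"
  assumes f: "continuous_on (ball 0 1) f" and s: "0 \<le> s" "s < 1" and \<eta>: "\<eta> > 0"
  shows "\<exists>R\<ge>0. R < 1 \<and> (\<forall>x. norm x \<le> s \<longrightarrow> \<bar>f x - f (R *\<^sub>R x)\<bar> < \<eta>)"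
proof -
  have "uniformly_continuous_on (cball 0 s) f"
    using s by (intro compact_uniformly_continuous continuous_on_subset[OF f]) auto
  then obtain d where d: "d > 0"
    "\<And>x y. x \<in> cball 0 s \<Longrightarrow> y \<in> cball 0 s \<Longrightarrow> dist y x < d \<Longrightarrow> dist (f y) (f x) < \<eta>"
    using \<eta> unfolding uniformly_continuous_on_def by meson
  \<comment> \<open>The maximum with 0 keeps \<open>R\<close> nonnegative for large
    \<open>d\<close>; in either case \<open>1 - R < d\<close>, and dilation moves points of the ball
    by at most \<open>1 - R\<close>.\<close>
  define R where "R = max 0 (1 - d / 2)"
  have R: "0 \<le> R" "R < 1" "1 - R < d" using d(1) by (auto simp: R_def)
  have "\<bar>f x - f (R *\<^sub>R x)\<bar> < \<eta>" if x: "norm x \<le> s" for x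
  proof -
    have "R * norm x \<le> 1 * norm x" using R by (intro mult_right_mono) auto
    then have "R *\<^sub>R x \<in> cball 0 s" using x R by simp
    have "dist x (R *\<^sub>R x) = (1 - R) * norm x"
    proof -
      have "x - R *\<^sub>R x = (1 - R) *\<^sub>R x" by (simp add: algebra_simps)
      then show ?thesis using R by (simp add: dist_norm)
    qed
    also have "(1 - R) * norm x \<le> (1 - R) * 1" using x s R by (intro mult_left_mono) auto
    also have "(1 - R) * 1 < d" using R by simp
    finally have "dist x (R *\<^sub>R x) < d" .
    then show ?thesis using d(2)[of "R *\<^sub>R x" x] \<open>R *\<^sub>R x \<in> cball 0 s\<close> x by (simp add: dist_real_def)
  qed
  then show ?thesis using R by blast
qed

text \<open>The competitor is a dilation of \<open>f\<close>. For \<open>norm x \<le> s\<close>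
  uniform continuity makes the difference small and the weight is at most 1. Beyond
  \<open>s\<close>, both \<open>f x\<close> and \<open>f (R *\<^sub>R x)\<close> are bounded by
  \<open>M_inf f (norm x)\<close>, whence the factor 2.\<close>

lemma s1_le:
  fixes f :: "real^'n \<Rightarrow> real"
  assumes \<alpha>: "\<alpha> > 0" and p: "p > 0" and harm: "harmonic_on (ball 0 1) f" and \<eta>: "\<eta> > 0"
    and s: "0 \<le> s" "s < 1"
    and less: "\<And>r. s \<le> r \<Longrightarrow> r < 1 \<Longrightarrow> M_inf f r * (1 - r) powr \<alpha> < \<eta>"
  shows "s1 p \<alpha> f \<le> ennreal (2 * \<eta>)"
proof -
  obtain R where R: "0 \<le> R" "R < 1" "\<And>x. norm x \<le> s \<Longrightarrow> \<bar>f x - f (R *\<^sub>R x)\<bar> < \<eta>"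
    using dilation_uniformly_close[OF harmonic_on_imp_continuous_on[OF harm] s \<eta>] by blast
  have "\<bar>f x - f (R *\<^sub>R x)\<bar> * (1 - norm x) powr \<alpha> \<le> 2 * \<eta>" if x: "norm x < 1" for x
  proof (cases "norm x \<le> s")
    case True
    have "\<bar>f x - f (R *\<^sub>R x)\<bar> * (1 - norm x) powr \<alpha> \<le> \<eta> * 1"
      using R(3)[OF True] \<alpha> x \<eta> powr_mono2[of \<alpha> "1 - norm x" 1] by (intro mult_mono) auto
    then show ?thesis using \<eta> by simp
  next
    case False
    have "R * norm x \<le> 1 * norm x" using R by (intro mult_right_mono) auto
    then have "\<bar>f x - f (R *\<^sub>R x)\<bar> \<le> 2 * M_inf f (norm x)"
      using abs_le_M_inf[OF harm, of x "norm x"] abs_le_M_inf[OF harm, of "R *\<^sub>R x" "norm x"] x R by simp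
    then have "\<bar>f x - f (R *\<^sub>R x)\<bar> * (1 - norm x) powr \<alpha> \<le> 2 * M_inf f (norm x) * (1 - norm x) powr \<alpha>"
      by (intro mult_right_mono) auto
    also have "\<dots> \<le> 2 * \<eta>" using less[of "norm x"] x False by simp
    finally show ?thesis .
  qed
  then have "A_norm \<alpha> (\<lambda>x. f x - f (R *\<^sub>R x)) \<le> ennreal (2 * \<eta>)"
    unfolding A_norm_def by (intro SUP_least ennreal_leI) auto
  then show ?thesis
    unfolding s1_def using dilation_in_B_space[OF \<alpha> p harm R(1,2)] by (rule INF_lower2[rotated])
qed

text \<open>With \<open>a\<close> the norm of \<open>f - g\<close>,
  \<open>M_inf f r * (1 - r) powr \<alpha>\<close> is at most \<open>a\<close> plus the same
  quantity for \<open>g\<close>, which is eventually below any \<open>e > 0\<close>. So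
  \<open>L_hat (a + e) \<alpha> f\<close> stays away from 1.\<close>

lemma s2_le_A_norm_diff:
  fixes f g :: "real^'n \<Rightarrow> real"
  assumes \<alpha>: "\<alpha> > 0" and p: "p > 0" and g: "g \<in> B_space p \<alpha>"
  shows "s2 p \<alpha> f \<le> A_norm \<alpha> (\<lambda>x. f x - g x)"
proof (rule ennreal_le_epsilon)
  fix e :: real assume fin: "A_norm \<alpha> (\<lambda>x. f x - g x) < top" and e: "0 < e"
  obtain a where a: "0 \<le> a" "A_norm \<alpha> (\<lambda>x. f x - g x) = ennreal a"
    using fin by (cases "A_norm \<alpha> (\<lambda>x. f x - g x)") auto
  have harm: "harmonic_on (ball 0 1) g" using g by (simp add: B_space_def)
  obtain s where s: "0 \<le> s" "s < 1" "\<And>r. s \<le> r \<Longrightarrow> r < 1 \<Longrightarrow> M_inf g r * (1 - r) powr \<alpha> < e"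
    using B_space_M_inf_eventually_less[OF \<alpha> p g e] by blast
  have "M_inf f r * (1 - r) powr \<alpha> < a + e" if r: "s \<le> r" "r < 1" for r
  proof -
    have pos: "(1 - r) powr \<alpha> > 0" using r by simp
    have "M_inf f r \<le> a / (1 - r) powr \<alpha> + M_inf g r"
    proof (rule M_inf_leI)
      fix x :: "real^'n" assume x: "norm x = r"
      then have "ennreal (\<bar>f x - g x\<bar> * (1 - r) powr \<alpha>) \<le> ennreal a"
        using r unfolding a(2)[symmetric] A_norm_def by (intro SUP_upper2[of x]) auto
      then have "\<bar>f x - g x\<bar> \<le> a / (1 - r) powr \<alpha>"
        using a(1) pos by (simp add: pos_le_divide_eq)
      then show "\<bar>f x\<bar> \<le> a / (1 - r) powr \<alpha> + M_inf g r"
        using abs_le_M_inf[OF harm, of x r] x r by simp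
    qed (use s r in simp)
    then have "M_inf f r * (1 - r) powr \<alpha> \<le> (a / (1 - r) powr \<alpha> + M_inf g r) * (1 - r) powr \<alpha>"
      by (rule mult_right_mono) simp
    also have "\<dots> = a + M_inf g r * (1 - r) powr \<alpha>" using pos r by (simp add: distrib_right)
    finally show ?thesis using s(3)[OF r] by simp
  qed
  then have "L_integral p \<alpha> (a + e) f < \<infinity>" by (rule L_integral_finite[OF \<alpha> p s(1,2)])
  then have "s2 p \<alpha> f \<le> ennreal (a + e)"
    unfolding s2_def using a(1) e by (intro INF_lower) auto
  then show "s2 p \<alpha> f \<le> A_norm \<alpha> (\<lambda>x. f x - g x) + ennreal e"
    using a e by simp
qed

section \<open>Comparison of \<open>s1\<close> and \<open>s2\<close>\<close>

theorem theorem2p4: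
  fixes \<alpha> p :: real
  assumes "\<alpha> > 0" and "0 < p" and "p \<le> 1"
  shows "\<exists>C::real. C \<ge> 1 \<and>
           (\<forall>f \<in> (A_space \<alpha> :: (real^'n \<Rightarrow> real) set).
              ennreal (1 / C) * s2 p \<alpha> f \<le> s1 p \<alpha> f \<and>
              s1 p \<alpha> f \<le> ennreal C * s2 p \<alpha> f)"
proof (intro exI[of _ "2 * 2 powr \<alpha>"] conjI ballI)
  \<comment> \<open>The 2 comes from \<open>s1_le\<close>, the \<open>2 powr \<alpha>\<close> from
    the threshold in \<open>L_integral_finite_imp_M_inf_eventually_less\<close>. The other
    inequality holds even with constant 1.\<close>
  let ?C = "2 * 2 powr \<alpha> :: real"
  have "1 \<le> (2::real) powr \<alpha>" using assms by (intro ge_one_powr_ge_zero) auto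
  then show C: "?C \<ge> 1" by simp
  fix f :: "real^'n \<Rightarrow> real" assume "f \<in> A_space \<alpha>"
  then have harm: "harmonic_on (ball 0 1) f" by (simp add: A_space_def)
  have "ennreal (1 / ?C) * s2 p \<alpha> f \<le> 1 * s2 p \<alpha> f"
    using C by (intro mult_right_mono) (auto simp: ennreal_le_1 simp del: times_divide_eq_right)
  also have "\<dots> \<le> s1 p \<alpha> f"
    unfolding s1_def using s2_le_A_norm_diff[OF assms(1,2)] by (auto intro: INF_greatest)
  finally show "ennreal (1 / ?C) * s2 p \<alpha> f \<le> s1 p \<alpha> f" .
  \<comment> \<open>Moving the constant to the left makes this a lower bound for an infimum, to be
    checked for each admissible \<open>\<epsilon>\<close>.\<close>
  have "s1 p \<alpha> f / ennreal ?C \<le> s2 p \<alpha> f"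
    unfolding s2_def
  proof (rule INF_greatest)
    fix \<epsilon> assume "\<epsilon> \<in> {\<epsilon>. 0 < \<epsilon> \<and> L_integral p \<alpha> \<epsilon> f < \<infinity>}"
    then have \<epsilon>: "0 < \<epsilon>" "L_integral p \<alpha> \<epsilon> f < \<infinity>" by auto
    obtain s where "0 \<le> s" "s < 1"
      "\<And>r. s \<le> r \<Longrightarrow> r < 1 \<Longrightarrow> M_inf f r * (1 - r) powr \<alpha> < 2 powr \<alpha> * \<epsilon>"
      using L_integral_finite_imp_M_inf_eventually_less[OF assms(1,2) harm \<epsilon>(2)] by blast
    then have "s1 p \<alpha> f \<le> ennreal (2 * (2 powr \<alpha> * \<epsilon>))"
      using \<epsilon>(1) by (intro s1_le[OF assms(1,2) harm]) auto
    also have "\<dots> = ennreal ?C * ennreal \<epsilon>"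
      using \<epsilon>(1) by (simp add: ennreal_mult[symmetric] mult_ac)
    finally show "s1 p \<alpha> f / ennreal ?C \<le> ennreal \<epsilon>"
      by (intro divide_le_posI_ennreal) auto
  qed
  then have "ennreal ?C * (s1 p \<alpha> f / ennreal ?C) \<le> ennreal ?C * s2 p \<alpha> f"
    by (rule mult_left_mono) simp
  then show "s1 p \<alpha> f \<le> ennreal ?C * s2 p \<alpha> f"
    by (simp add: ennreal_times_divide ennreal_mult_divide_eq mult.commute)
qed

end
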